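(* Let $\mathcal{T}=(t_{ijkl})\in\widehat{\mathcal{E}}_{4,3}$. Call a permutation $(i,j,k)$ of $(1,2,3)$ admissible if $$t_{iiij}t_{ijjj}=0,\qquad t_{jjjk}t_{jkkk}=t_{iiik}t_{ikkk}=-1,$$ and suppose that an admissible permutation exists. Then $\mathcal{T}$ is positive semi-definite if and only if there is an admissible permutation $(i,j,k)$ for which one of the following conditions is satisfied. (a) $t_{iiij}=t_{ijjj}=0$, $t_{iijk}=t_{ijjk}=0$, $t_{jjjk}t_{iiik}t_{ijkk}=1$, $t_{iijj}\in\{0,1\}$ and $t_{jjkk}=t_{iikk}=1$. (b) $t_{ijjj}=0$, $t_{iiij}t_{jkkk}t_{ikkk}=1$, $t_{iijk}t_{iiij}t_{iiik}=1$, $t_{1122}=t_{2233}=t_{1133}=1$, and either $t_{ijjk}=t_{ijkk}=0$, or $t_{iijk}t_{ijjk}t_{ijkk}=1$ with $t_{iiij}t_{ijkk}=1$.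
   Context: A 4th order 3-dimensional real tensor $\mathcal{T}=(t_{ijkl})_{i,j,k,l\in\{1,2,3\}}$ is symmetric if its entries are invariant under all permutations of the four indices (so, e.g., $t_{ijjk}$ denotes the common value of all entries whose index multiset is $\{i,j,j,k\}$). $\widehat{\mathcal{E}}_{4,3}$ is the set of symmetric 4th order 3-dimensional tensors all of whose entries lie in $\{-1,0,1\}$ and whose diagonal entries satisfy $t_{1111}=t_{2222}=t_{3333}=1$. For $x\in\mathbb{R}^3$ put $\mathcal{T}x^4=\sum_{i,j,k,l=1}^3 t_{ijkl}x_ix_jx_kx_l$. $\mathcal{T}$ is positive semi-definite if $\mathcal{T}x^4\ge 0$ for all $x\in\mathbb{R}^3$. *)

theory Defs
  imports "HOL-Analysis.Analysis"
begin

text \<open>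
  A 4th order 3-dimensional tensor is a function of four indices of the three-element
  numeral type \<^typ>\<open>3\<close>, whose elements are \<open>1\<close>, \<open>2\<close> and \<open>3\<close> (with \<open>3 = 0\<close>).
\<close>
type_synonym tensor43 = "3 \<Rightarrow> 3 \<Rightarrow> 3 \<Rightarrow> 3 \<Rightarrow> real"

text \<open>\<open>ix 0, \<dots>, ix 3\<close> are the four indices of an entry; \<open>\<sigma>\<close> permutes their positions.\<close>
definition symmetric_tensor :: "tensor43 \<Rightarrow> bool" where
  "symmetric_tensor T \<longleftrightarrow>
     (\<forall>\<sigma> (ix :: nat \<Rightarrow> 3). \<sigma> permutes {..<4} \<longrightarrow>
        T (ix (\<sigma> 0)) (ix (\<sigma> 1)) (ix (\<sigma> 2)) (ix (\<sigma> 3)) = T (ix 0) (ix 1) (ix 2) (ix 3))"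

definition E_hat :: "tensor43 set" where
  "E_hat = {T. symmetric_tensor T \<and> (\<forall>i j k l. T i j k l \<in> {-1, 0, 1}) \<and>
               T 1 1 1 1 = 1 \<and> T 2 2 2 2 = 1 \<and> T 3 3 3 3 = 1}"

definition tensor_form :: "tensor43 \<Rightarrow> real ^ 3 \<Rightarrow> real" where
  "tensor_form T x =
     (\<Sum>i\<in>UNIV. \<Sum>j\<in>UNIV. \<Sum>k\<in>UNIV. \<Sum>l\<in>UNIV. T i j k l * x $ i * x $ j * x $ k * x $ l)"

definition positive_semidefinite :: "tensor43 \<Rightarrow> bool" where
  "positive_semidefinite T \<longleftrightarrow> (\<forall>x. tensor_form T x \<ge> 0)"

definition admissible :: "tensor43 \<Rightarrow> 3 \<Rightarrow> 3 \<Rightarrow> 3 \<Rightarrow> bool" where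
  "admissible T i j k \<longleftrightarrow>
     mset [i, j, k] = mset [1, 2, 3] \<and>
     T i i i j * T i j j j = 0 \<and>
     T j j j k * T j k k k = -1 \<and> T i i i k * T i k k k = -1"

end

theory Submission
  imports Defs
begin

text \<open>
  Write \<open>(x, y, z)\<close> for the coordinates \<open>(x\<^sub>i, x\<^sub>j, x\<^sub>k)\<close> of an admissible permutation. Changing the signs
  of \<open>x\<close> and \<open>y\<close> reduces to \<open>t\<^sub>i\<^sub>i\<^sub>i\<^sub>k = t\<^sub>j\<^sub>j\<^sub>j\<^sub>k = 1\<close>, \<open>t\<^sub>i\<^sub>k\<^sub>k\<^sub>k = t\<^sub>j\<^sub>k\<^sub>k\<^sub>k = -1\<close>. Evaluating the form at
  eleven integer points leaves six choices of the remaining entries. Up to exchanging \<open>x\<close> and \<open>y\<close> and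
  adding \<open>6x\<^sup>2y\<^sup>2\<close> these are three forms, each of which is an explicit sum of squares.
\<close>

text \<open>The multinomial expansion of the form, with the two sign conditions of admissibility
  built in: \<open>s\<close> stands for \<open>T i i i k\<close> and for \<open>- T i k k k\<close>,
  and \<open>t\<close> likewise with \<open>j\<close> in place of \<open>i\<close>. The letters
  \<open>u\<close>, \<open>v\<close>, \<open>w\<close> belong to the entries in which
  \<open>i\<close>, \<open>j\<close>, \<open>k\<close> respectively is the repeated index.\<close>

definition quartic ::
  "real \<Rightarrow> real \<Rightarrow> real \<Rightarrow> real \<Rightarrow> real \<Rightarrow> real \<Rightarrow> real \<Rightarrow> real \<Rightarrow> real \<Rightarrow> real \<Rightarrow> real \<Rightarrow> real \<Rightarrow> real \<Rightarrow> real"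
where
  "quartic a b s t p q r u v w x y z =
     x^4 + y^4 + z^4 + 4 * (a * x^3 * y + b * x * y^3)
     + 4 * s * (x^3 * z - x * z^3) + 4 * t * (y^3 * z - y * z^3)
     + 6 * (p * x^2 * y^2 + q * y^2 * z^2 + r * x^2 * z^2)
     + 12 * (u * x^2 * y * z + v * x * y^2 * z + w * x * y * z^2)"

text \<open>Since \<open>s\<close> and \<open>t\<close> square to 1, the substitution only affects
  monomials of odd degree in \<open>x\<close> or in \<open>y\<close>, which gain a factor
  \<open>s\<close> or \<open>t\<close>.\<close>

lemma quartic_change_signs:
  assumes "s \<in> {-1, 1}" "t \<in> {-1, 1}"
  shows "quartic a b s t p q r u v w x y z =
    quartic (a * s * t) (b * s * t) 1 1 p q r (u * t) (v * s) (w * s * t) (s * x) (t * y) z"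
  using assms by (auto simp: quartic_def algebra_simps)

lemma quartic_exchange:
  "quartic a b s t p q r u v w x y z = quartic b a t s p r q v u w y x z"
  by (simp add: quartic_def algebra_simps)

text \<open>The form at \<open>p = 0\<close> is a quadratic form in the six monomials of degree two,
  and its Gram matrix can be chosen freely up to relations such as
  \<open>x^2 * y^2 = (x*y)^2\<close>. For a suitable choice, completing squares in the order
  \<open>x^2\<close>, \<open>x*y\<close>, \<open>z^2\<close> leaves a multiple of one
  square.\<close>

lemma quartic_nonneg_a:
  assumes "p \<ge> 0"
  shows "quartic 0 0 1 1 p 1 1 0 0 1 x y z \<ge> 0"
proof -
  have "quartic 0 0 1 1 p 1 1 0 0 1 x y z =
      6 * p * x^2 * y^2 + (x^2 - y^2/4 - z^2/2 + 3/4*y*z + 2*x*z)^2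
      + 1/2 * (z^2/2 + x*y - 3/2*y*z - 3/2*x*z)^2
      + 5/8 * (- (y^2) + z^2 - 2*y*z - x*z)^2 + 5/16 * (y^2 + 3*y*z + 2*x*z)^2"
    unfolding quartic_def by (simp add: field_simps power2_eq_square power3_eq_cube power4_eq_xxxx)
  then show ?thesis using assms by simp
qed

text \<open>The same method, with squares completed in the order \<open>x^2\<close>,
  \<open>y^2\<close>, \<open>x*y\<close>, \<open>y*z\<close>; in \<open>quartic_nonneg_b'\<close>
  the order is \<open>x^2\<close>, \<open>x*y\<close>, \<open>x*z\<close>, \<open>y^2\<close>,
  \<open>z^2\<close>, \<open>y*z\<close>.\<close>

lemma quartic_nonneg_b:
  "quartic 1 0 1 1 1 1 1 1 0 0 x y z \<ge> 0"
proof -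
  have "quartic 1 0 1 1 1 1 1 1 0 0 x y z =
      (x^2 - 3/4*z^2 + 2*x*y + 1/2*y*z + 2*x*z)^2 + (y^2 - z^2/2 + 2*y*z)^2
      + 2 * (x*y - 1/2*y*z + 3/4*x*z)^2 + 9/4 * (- (5/18)*z^2 + y*z + 5/9*x*z)^2
      + 1/72 * (z^2 - 11*x*z)^2"
    unfolding quartic_def by (simp add: field_simps power2_eq_square power3_eq_cube power4_eq_xxxx)
  then show ?thesis by simp
qed

lemma quartic_nonneg_b':
  "quartic 1 0 1 1 1 1 1 1 1 1 x y z \<ge> 0"
proof -
  have "quartic 1 0 1 1 1 1 1 1 1 1 x y z =
      (x^2 + y^2/4 - z^2/2 + 2*x*y + 2*y*z + 2*x*z)^2 + 3/2 * (- (y^2)/3 + z^2/6 + x*y)^2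
      + 3 * (y^2/2 - z^2/3 + 11/12*y*z + x*z)^2 + 1/48 * (y^2 - 2*z^2 + 6*y*z)^2
      + 7/24 * (z^2 + 4/7*y*z)^2 + 15/112 * (y*z)^2"
    unfolding quartic_def by (simp add: field_simps power2_eq_square power3_eq_cube power4_eq_xxxx)
  then show ?thesis by simp
qed

text \<open>The six surviving coefficient choices, two per line; the last line mirrors the one
  before it under \<open>quartic_exchange\<close>.\<close>

definition normal_solution ::
  "real \<Rightarrow> real \<Rightarrow> real \<Rightarrow> real \<Rightarrow> real \<Rightarrow> real \<Rightarrow> real \<Rightarrow> real \<Rightarrow> bool"
where
  "normal_solution a b p q r u v w \<longleftrightarrow> q = 1 \<and> r = 1 \<and>
     (a = 0 \<and> b = 0 \<and> u = 0 \<and> v = 0 \<and> w = 1 \<and> p \<in> {0, 1} \<or>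
      p = 1 \<and> a = 1 \<and> b = 0 \<and> u = 1 \<and> (v = 0 \<and> w = 0 \<or> v = 1 \<and> w = 1) \<or>
      p = 1 \<and> a = 0 \<and> b = 1 \<and> v = 1 \<and> (u = 0 \<and> w = 0 \<or> u = 1 \<and> w = 1))"

text \<open>Undoes the sign normalisation. The disjuncts are condition (a), condition (b), and (b)
  with \<open>i\<close> and \<open>j\<close> exchanged; \<open>- s\<close> and \<open>- t\<close>
  are left standing where the theorem has \<open>T i k k k\<close> and
  \<open>T j k k k\<close>.\<close>

lemma normal_solution_signs_iff:
  assumes "s \<in> {-1, 1}" "t \<in> {-1, 1}"
  shows "normal_solution (a * s * t) (b * s * t) p q r (u * t) (v * s) (w * s * t) \<longleftrightarrow>
    (a = 0 \<and> b = 0 \<and> u = 0 \<and> v = 0 \<and> t * s * w = 1 \<and> p \<in> {0, 1} \<and> q = 1 \<and> r = 1) \<or>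
    (b = 0 \<and> a * - t * - s = 1 \<and> u * a * s = 1 \<and> p = 1 \<and> q = 1 \<and> r = 1 \<and>
      (v = 0 \<and> w = 0 \<or> u * v * w = 1 \<and> a * w = 1)) \<or>
    (a = 0 \<and> b * - s * - t = 1 \<and> v * b * t = 1 \<and> p = 1 \<and> r = 1 \<and> q = 1 \<and>
      (u = 0 \<and> w = 0 \<or> v * u * w = 1 \<and> b * w = 1))"
proof -
  have "s = 1 \<and> t = 1 \<or> s = 1 \<and> t = -1 \<or> s = -1 \<and> t = 1 \<or> s = -1 \<and> t = -1"
    using assms by auto
  then show ?thesis
    unfolding normal_solution_def
    by (elim disjE conjE; simp add: minus_equation_iff[of _ 1]; (intro iffI; elim disjE conjE; simp))
qed

lemma normal_solution_if_quartic_nonneg: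
  assumes entries: "a \<in> {-1, 0, 1}" "b \<in> {-1, 0, 1}" "p \<in> {-1, 0, 1}" "q \<in> {-1, 0, 1}"
      "r \<in> {-1, 0, 1}" "u \<in> {-1, 0, 1}" "v \<in> {-1, 0, 1}" "w \<in> {-1, 0, 1}"
    and "a * b = 0"
    and nonneg: "\<And>x y z. quartic a b 1 1 p q r u v w x y z \<ge> 0"
  shows "normal_solution a b p q r u v w"
proof -
  note N = nonneg[unfolded quartic_def]
  \<comment> \<open>The value at this point is \<open>24 * q - 7\<close>; the next point treats
    \<open>r\<close> in the same way.\<close>
  have q: "q = 1" using entries N[of 0 1 2] by auto
  have r: "r = 1" using entries N[of 1 0 2] by auto
  \<comment> \<open>With \<open>q\<close> and \<open>r\<close> known, 5 * 81 = 405 candidates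
    remain, and these nine points refute all but six. For example, (1,1,4) gives
    \<open>-30 + 4*(a+b) + 6*p + 48*(u+v+4*w)\<close>, which excludes \<open>w = -1\<close>, and
    (-1,1,0) gives \<open>2 - 4*(a+b) + 6*p\<close>. Up to sign the set of points is closed under
    exchanging \<open>x\<close> and \<open>y\<close>.\<close>
  note points = N[of 1 1 4] N[of "-4" "-4" 1] N[of "-7" 3 4] N[of 3 "-7" 4] N[of "-3" "-1" 1]
    N[of "-1" "-3" 1] N[of "-1" 1 0] N[of "-6" "-2" 1] N[of "-2" "-6" 1]
  note ineqs = points[unfolded q r, simplified]
  have disj: "p = -1 \<or> p = 0 \<or> p = 1" "u = -1 \<or> u = 0 \<or> u = 1" "v = -1 \<or> v = 0 \<or> v = 1"
      "w = -1 \<or> w = 0 \<or> w = 1"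
    using entries by auto
  from \<open>a * b = 0\<close> entries(1,2) consider "a = 0" "b = 0" | "a = 0" "b = 1" | "a = 0" "b = -1"
    | "a = 1" "b = 0" | "a = -1" "b = 0" by auto
  then show ?thesis
    unfolding normal_solution_def using q r disj ineqs by cases (smt (verit) insertI1 insertI2)+
qed

lemma quartic_nonneg_if_normal_solution:
  assumes "normal_solution a b p q r u v w"
  shows "quartic a b 1 1 p q r u v w x y z \<ge> 0"
  using assms quartic_nonneg_a[of p x y z] quartic_nonneg_b[of x y z] quartic_nonneg_b'[of x y z]
    quartic_nonneg_b[of y x z] quartic_nonneg_b'[of y x z]
    quartic_exchange[of 0 1 1 1 1 1 1 0 1 0 x y z] quartic_exchange[of 0 1 1 1 1 1 1 1 1 1 x y z]
  unfolding normal_solution_def by auto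

text \<open>Adjacent transpositions generate all permutations; as ordered rewrite rules these
  equations sort the indices of an entry.\<close>

lemma symmetric_tensor_swaps:
  assumes "symmetric_tensor T"
  shows "T b a c d = T a b c d" "T a c b d = T a b c d" "T a b d c = T a b c d"
proof -
  have perm: "T ([a, b, c, d] ! \<sigma> 0) ([a, b, c, d] ! \<sigma> 1) ([a, b, c, d] ! \<sigma> 2) ([a, b, c, d] ! \<sigma> 3)
      = T a b c d" if "\<sigma> permutes {..<4}" for \<sigma> :: "nat \<Rightarrow> nat"
    using assms that unfolding symmetric_tensor_def
    by (auto dest!: spec[of _ \<sigma>] spec[of _ "(!) [a, b, c, d]"] simp: numeral_3_eq_3 numeral_2_eq_2)
  show "T b a c d = T a b c d"
    using perm[of "Transposition.transpose 0 1"] by (simp add: permutes_swap_id Transposition.transpose_def)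
  show "T a c b d = T a b c d"
    using perm[of "Transposition.transpose 1 2"] by (simp add: permutes_swap_id Transposition.transpose_def)
  show "T a b d c = T a b c d"
    using perm[of "Transposition.transpose 2 3"] by (simp add: permutes_swap_id Transposition.transpose_def)
qed

text \<open>Allows expanding the form directly in the variables \<open>i\<close>, \<open>j\<close>,
  \<open>k\<close>, without splitting into six permutations.\<close>

lemma sum_three:
  fixes f :: "3 \<Rightarrow> real"
  assumes "mset [i, j, k] = mset [1, 2, 3 :: 3]"
  shows "(\<Sum>m\<in>UNIV. f m) = f i + f j + f k"
proof -
  have "sum f UNIV = sum_mset (image_mset f (mset [1, 2, 3]))"
    by (simp add: sum_3)
  then show ?thesis
    unfolding assms[symmetric] by simp
qed

lemma tensor_form_eq_quartic:
  assumes sym: "symmetric_tensor T" and perm: "mset [i, j, k] = mset [1, 2, 3]"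
    and "T i k k k = - T i i i k" "T j k k k = - T j j j k"
    and "T i i i i = 1" "T j j j j = 1" "T k k k k = 1"
  shows "tensor_form T x = quartic (T i i i j) (T i j j j) (T i i i k) (T j j j k)
    (T i i j j) (T j j k k) (T i i k k) (T i i j k) (T i j j k) (T i j k k) (x $ i) (x $ j) (x $ k)"
  unfolding tensor_form_def sum_three[OF perm] quartic_def
  \<comment> \<open>Sorting indices identifies equal entries among the 81 terms; a polynomial
    identity remains.\<close>
  by (simp only: symmetric_tensor_swaps[OF sym] assms(3-)) algebra

lemma permutation_of_3_cases:
  assumes "mset [i, j, k] = mset [1, 2, 3 :: 3]"
  shows "(i, j, k) \<in> {(1, 2, 3), (1, 3, 2), (2, 1, 3), (2, 3, 1), (3, 1, 2), (3, 2, 1)}"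
proof -
  have distinct: "distinct [i, j, k]"
    using mset_eq_imp_distinct_iff[OF assms] by simp
  show ?thesis
    using distinct exhaust_3[of i] exhaust_3[of j] exhaust_3[of k] by auto
qed

lemma positive_semidefinite_iff_normal_solution:
  assumes T: "T \<in> E_hat" and adm: "admissible T i j k"
  defines "s \<equiv> T i i i k" and "t \<equiv> T j j j k"
  shows "positive_semidefinite T \<longleftrightarrow>
    normal_solution (T i i i j * s * t) (T i j j j * s * t) (T i i j j) (T j j k k) (T i i k k)
      (T i i j k * t) (T i j j k * s) (T i j k k * s * t)"
proof -
  have sym: "symmetric_tensor T" and ent: "T a b c d \<in> {-1, 0, 1}" for a b c d
    using T by (auto simp: E_hat_def)
  have diag: "T m m m m = 1" for m
    using T exhaust_3[of m] by (auto simp: E_hat_def)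
  have perm: "mset [i, j, k] = mset [1, 2, 3]"
    and ab: "T i i i j * T i j j j = 0" and tk: "t * T j k k k = -1" and sk: "s * T i k k k = -1"
    using adm by (auto simp: admissible_def s_def t_def)
  have neq: "i \<noteq> j" "i \<noteq> k" "j \<noteq> k"
    using permutation_of_3_cases[OF perm] by auto
  have s: "s \<in> {-1, 1}" "T i k k k = - s"
    using ent[of i i i k] ent[of i k k k] sk by (auto simp: s_def)
  have t: "t \<in> {-1, 1}" "T j k k k = - t"
    using ent[of j j j k] ent[of j k k k] tk by (auto simp: t_def)
  define Q where "Q = quartic (T i i i j * s * t) (T i j j j * s * t) 1 1 (T i i j j) (T j j k k)
    (T i i k k) (T i i j k * t) (T i j j k * s) (T i j k k * s * t)"
  have form: "tensor_form T x = Q (s * x $ i) (t * x $ j) (x $ k)" for x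
    using tensor_form_eq_quartic[OF sym perm, of x] s(2) t(2) diag
    unfolding Q_def quartic_change_signs[OF s(1) t(1), symmetric] by (simp add: s_def t_def)
  have "positive_semidefinite T \<longleftrightarrow> (\<forall>x y z. Q x y z \<ge> 0)"
  proof
    assume psd: "positive_semidefinite T"
    show "\<forall>x y z. Q x y z \<ge> 0"
    proof (intro allI)
      fix x y z
      \<comment> \<open>Every triple is reached, because multiplying by \<open>s\<close> or
        \<open>t\<close> is its own inverse.\<close>
      have "tensor_form T (\<chi> m. if m = i then s * x else if m = j then t * y else z) = Q x y z"
        unfolding form using s(1) t(1) neq by auto
      then show "Q x y z \<ge> 0"
        using psd unfolding positive_semidefinite_def by metis
    qed
  qed (simp add: positive_semidefinite_def form)
  also have "\<dots> \<longleftrightarrow> normal_solution (T i i i j * s * t) (T i j j j * s * t) (T i i j j) (T j j k k)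
      (T i i k k) (T i i j k * t) (T i j j k * s) (T i j k k * s * t)"
  proof
    assume nonneg: "\<forall>x y z. Q x y z \<ge> 0"
    have signed: "c * s \<in> {-1, 0, 1}" "c * t \<in> {-1, 0, 1}" if "c \<in> {-1, 0, 1}" for c
      using that s(1) t(1) by auto
    show "normal_solution (T i i i j * s * t) (T i j j j * s * t) (T i i j j) (T j j k k)
      (T i i k k) (T i i j k * t) (T i j j k * s) (T i j k k * s * t)"
      using nonneg ab unfolding Q_def
      by (intro normal_solution_if_quartic_nonneg signed ent) auto
  qed (simp add: Q_def quartic_nonneg_if_normal_solution)
  finally show ?thesis .
qed

theorem theorem3p7:
  fixes T :: tensor43
  assumes "T \<in> E_hat"
    and "\<exists>i j k. admissible T i j k"
  shows "positive_semidefinite T \<longleftrightarrow>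
    (\<exists>i j k. admissible T i j k \<and>
      ((T i i i j = 0 \<and> T i j j j = 0 \<and>
        T i i j k = 0 \<and> T i j j k = 0 \<and>
        T j j j k * T i i i k * T i j k k = 1 \<and>
        T i i j j \<in> {0, 1} \<and>
        T j j k k = 1 \<and> T i i k k = 1)
      \<or>
       (T i j j j = 0 \<and>
        T i i i j * T j k k k * T i k k k = 1 \<and>
        T i i j k * T i i i j * T i i i k = 1 \<and>
        T 1 1 2 2 = 1 \<and> T 2 2 3 3 = 1 \<and> T 1 1 3 3 = 1 \<and>
        ((T i j j k = 0 \<and> T i j k k = 0) \<or>
         (T i i j k * T i j j k * T i j k k = 1 \<and> T i i i j * T i j k k = 1)))))"
proof -
  let ?pair = "T 1 1 2 2 = 1 \<and> T 2 2 3 3 = 1 \<and> T 1 1 3 3 = 1"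
  have sym: "symmetric_tensor T" and ent: "T a b c d \<in> {-1, 0, 1}" for a b c d
    using assms(1) by (auto simp: E_hat_def)
  note swap = symmetric_tensor_swaps[OF sym]
  \<comment> \<open>\<open>?pair\<close> concerns all three unordered pairs of indices, so it reads
    the same for every permutation. Admissibility is symmetric in its first two indices.\<close>
  have admD: "T i i i k \<in> {-1, 1} \<and> T j j j k \<in> {-1, 1} \<and> T i k k k = - T i i i k \<and>
      T j k k k = - T j j j k \<and> (?pair \<longleftrightarrow> T i i j j = 1 \<and> T j j k k = 1 \<and> T i i k k = 1) \<and>
      admissible T j i k"
    if "admissible T i j k" for i j k
  proof -
    have perm: "mset [i, j, k] = mset [1, 2, 3]"
      and tk: "T j j j k * T j k k k = -1" and sk: "T i i i k * T i k k k = -1"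
      using that by (auto simp: admissible_def)
    have signs: "s \<in> {-1, 1} \<and> s' = - s" if "s * s' = -1" "s \<in> {-1, 0, 1}" "s' \<in> {-1, 0, 1}" for s s' :: real
      using that by auto
    have "?pair \<longleftrightarrow> T i i j j = 1 \<and> T j j k k = 1 \<and> T i i k k = 1"
      using permutation_of_3_cases[OF perm] by (auto simp: swap)
    moreover have "admissible T j i k"
      using that by (auto simp: admissible_def swap add_mset_commute)
    ultimately show ?thesis
      using signs[OF sk ent ent] signs[OF tk ent ent] by blast
  qed
  show ?thesis (is "_ \<longleftrightarrow> (\<exists>i j k. admissible T i j k \<and> (?A i j k \<or> ?B i j k))")
  proof -
    \<comment> \<open>Any admissible permutation decides semi-definiteness. Condition (a) is
      invariant under exchanging \<open>i\<close> and \<open>j\<close>, so only (b) needs its mirror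
      image; the existential quantifier absorbs it, as \<open>(j, i, k)\<close> is admissible
      too.\<close>
    have iff: "positive_semidefinite T \<longleftrightarrow> ?A i j k \<or> ?B i j k \<or> ?B j i k"
      if adm: "admissible T i j k" for i j k
    proof -
      have s: "T i i i k \<in> {-1, 1}" and t: "T j j j k \<in> {-1, 1}"
        and neg: "T i k k k = - T i i i k" "T j k k k = - T j j j k"
        and pairs: "?pair \<longleftrightarrow> T i i j j = 1 \<and> T j j k k = 1 \<and> T i i k k = 1"
        using admD[OF adm] by blast+
      have entries: "T j j j i = T i j j j" "T j i i i = T i i i j" "T j j i k = T i j j k"
        "T j i i k = T i i j k" "T j i k k = T i j k k"
        by (simp_all add: swap)
      show ?thesis
        unfolding positive_semidefinite_iff_normal_solution[OF assms(1) adm]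
          normal_solution_signs_iff[OF s t] entries neg
        using pairs by argo
    qed
    show ?thesis
    proof
      assume psd: "positive_semidefinite T"
      obtain i j k where adm: "admissible T i j k"
        using assms(2) by blast
      then have "admissible T j i k"
        using admD by blast
      moreover have "?A i j k \<or> ?B i j k \<or> ?B j i k"
        using psd iff[OF adm] by (rule iffD1[rotated])
      ultimately show "\<exists>i j k. admissible T i j k \<and> (?A i j k \<or> ?B i j k)"
        using adm by metis
    next
      assume "\<exists>i j k. admissible T i j k \<and> (?A i j k \<or> ?B i j k)"
      then obtain i j k where adm: "admissible T i j k" and AB: "?A i j k \<or> ?B i j k"
        by (elim exE conjE)
      then have "?A i j k \<or> ?B i j k \<or> ?B j i k"
        by argo
      then show "positive_semidefinite T"
        by (rule iffD2[OF iff[OF adm]])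
    qed
  qed
qed

end
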